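(* For $C\in\mathbb{C}^{\ell\times\ell}$ and an entrywise nonnegative $R\in\mathbb{R}_+^{\ell\times\ell}$, let $\langle C,R\rangle$ denote the interval matrix with center $C$ and radius $R$, i.e. the set of all $Z\in\mathbb{C}^{\ell\times\ell}$ with $|Z-C|\le R$ entrywise. Let $\tilde{\mathsf M}_k^{(N)}\in\mathbb{C}^{\ell\times\ell}$ be the matrix obtained by numerically computing $\mathsf M_k^{(N)}$ (an arbitrary matrix, possibly affected by rounding errors). Then, for $k=0,1,\dots,2m-1$, $$\mathsf{M}_{k,\mathrm{in}}^{(N)}\in\left\langle \mathsf{M}_k^{(N)},\left|\mathsf{M}_{k,\mathrm{out}}^{(N)}\right|\right\rangle\subset\left\langle\tilde{\mathsf M}_k^{(N)},\left|\mathsf{M}_{k,\mathrm{out}}^{(N)}\right|+\left|\tilde{\mathsf M}_k^{(N)}-\mathsf M_k^{(N)}\right|\right\rangle,$$ where $|\cdot|$ is the entrywise modulus.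
   Context: Setting. $A=A^{\mathsf H}\in\mathbb{C}^{n\times n}$, $B=B^{\mathsf H}\in\mathbb{C}^{n\times n}$ is positive semidefinite, $r=\mathrm{rank}\,B$, and the pencil $zB-A$ is regular. Fix a nonsingular $X=[\boldsymbol{x}_1,\dots,\boldsymbol{x}_n]\in\mathbb{C}^{n\times n}$ giving the Weierstrass canonical form $X^{\mathsf H}(zB-A)X=z\,(\mathrm{I}_r\oplus \mathrm{O})-\Lambda$ with $\Lambda=\mathrm{diag}(\lambda_1,\dots,\lambda_r)\oplus \mathrm{I}_{n-r}$, where $\oplus$ is the direct sum of matrices. The $\lambda_i\in\mathbb{R}$ ($i=1,\dots,r$) are the eigenvalues, with multiplicity, of $A\boldsymbol{x}=\lambda B\boldsymbol{x}$, with corresponding $B$-orthonormal eigenvectors $\boldsymbol{x}_i$. Let $\Omega=[a,b]\subset\mathbb{R}$ ($a<b$), $\gamma=(a+b)/2$, $\rho=(b-a)/2$. Exactly $t$ eigenvalues, $\lambda_1,\dots,\lambda_t$, lie in $\Omega$, neither $a$ nor $b$ is an eigenvalue, and $\lambda_{t+1},\dots,\lambda_r$ lie outside $\Omega$. Let $N,\ell,m$ be positive integers and $V\in\mathbb{C}^{n\times\ell}$. Put $$d_i^{(N)}=\frac{1}{1-\left(\frac{\lambda_i-\gamma}{\rho}\right)^N}\ (i=1,\dots,t),\qquad d_i^{(N)}=\frac{-\left(\frac{\rho}{\lambda_i-\gamma}\right)^N}{1-\left(\frac{\rho}{\lambda_i-\gamma}\right)^N}\ (i=t+1,\dots,r).$$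 For $k=0,\dots,m-1$ let $$M_{k,\mathrm{in}}^{(N)}=\sum_{i=1}^t(\lambda_i-\gamma)^kd_i^{(N)}\boldsymbol{x}_i\boldsymbol{x}_i^{\mathsf H},\quad M_{k,\mathrm{out}}^{(N)}=\sum_{i=t+1}^r(\lambda_i-\gamma)^kd_i^{(N)}\boldsymbol{x}_i\boldsymbol{x}_i^{\mathsf H},\quad M_k^{(N)}=M_{k,\mathrm{in}}^{(N)}+M_{k,\mathrm{out}}^{(N)},$$ and $S_{k}^{(N)}=M_{k}^{(N)}BV$, $S_{k,\mathrm{in}}^{(N)}=M_{k,\mathrm{in}}^{(N)}BV$, $S_{k,\mathrm{out}}^{(N)}=M_{k,\mathrm{out}}^{(N)}BV$. The approximated reduced complex moments $\mathsf M_k^{(N)}\in\mathbb{C}^{\ell\times\ell}$, $k=0,\dots,2m-1$, are given by $$\mathsf{M}_{i+j}^{(N)}=(S_i^{(N)})^{\mathsf H}B\,S_j^{(N)},\qquad \mathsf{M}_{i+j+1}^{(N)}=(S_i^{(N)})^{\mathsf H}(A-\gamma B)S_j^{(N)},\qquad i,j=0,\dots,m-1$$ (these depend only on the index sum), and $\mathsf M_{k,\mathrm{in}}^{(N)}$, $\mathsf M_{k,\mathrm{out}}^{(N)}$ are defined by the same formulas with $S_i^{(N)},S_j^{(N)}$ replaced by $S_{i,\mathrm{in}}^{(N)},S_{j,\mathrm{in}}^{(N)}$, respectively $S_{i,\mathrm{out}}^{(N)},S_{j,\mathrm{out}}^{(N)}$. *)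

theory Defs
  imports
    "Jordan_Normal_Form.DL_Rank"
    "Jordan_Normal_Form.Schur_Decomposition"
begin

definition hermitian_mat :: "complex mat \<Rightarrow> bool" where
  "hermitian_mat A \<longleftrightarrow> square_mat A \<and> mat_adjoint A = A"

definition psd_mat :: "complex mat \<Rightarrow> bool" where
  "psd_mat B \<longleftrightarrow> hermitian_mat B \<and>
     (\<forall>v \<in> carrier_vec (dim_row B). Re ((B *\<^sub>v v) \<bullet>c v) \<ge> 0)"

definition regular_pencil :: "complex mat \<Rightarrow> complex mat \<Rightarrow> bool" where
  "regular_pencil A B \<longleftrightarrow> (\<exists>z. det (z \<cdot>\<^sub>m B - A) \<noteq> 0)"

definition pencil_eigenvalue :: "complex mat \<Rightarrow> complex mat \<Rightarrow> complex \<Rightarrow> bool" where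
  "pencil_eigenvalue A B z \<longleftrightarrow>
     (\<exists>v \<in> carrier_vec (dim_col A). v \<noteq> 0\<^sub>v (dim_col A) \<and> A *\<^sub>v v = z \<cdot>\<^sub>v (B *\<^sub>v v))"

text \<open>Indices are 0-based throughout: the eigenvalues are \<open>lam 0, \<dots>, lam (r - 1)\<close>, and the
  eigenvector for \<open>lam i\<close> is column \<open>i\<close> of \<open>X\<close>; values \<open>lam i\<close> with \<open>i \<ge> r\<close> are irrelevant.\<close>

definition weierstrass_form ::
  "nat \<Rightarrow> nat \<Rightarrow> complex mat \<Rightarrow> complex mat \<Rightarrow> complex mat \<Rightarrow> (nat \<Rightarrow> real) \<Rightarrow> bool" where
  "weierstrass_form n r A B X lam \<longleftrightarrow>
     X \<in> carrier_mat n n \<and> invertible_mat X \<and>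
     (\<forall>z. mat_adjoint X * (z \<cdot>\<^sub>m B - A) * X =
        z \<cdot>\<^sub>m diag_block_mat [1\<^sub>m r, 0\<^sub>m (n - r) (n - r)]
        - diag_block_mat [mat r r (\<lambda>(i, j). if i = j then complex_of_real (lam i) else 0),
                          1\<^sub>m (n - r)])"

definition filter_coeff :: "real \<Rightarrow> real \<Rightarrow> nat \<Rightarrow> nat \<Rightarrow> (nat \<Rightarrow> real) \<Rightarrow> nat \<Rightarrow> real" where
  "filter_coeff \<gamma> \<rho> N t lam i =
     (if i < t then 1 / (1 - ((lam i - \<gamma>) / \<rho>) ^ N)
      else - ((\<rho> / (lam i - \<gamma>)) ^ N) / (1 - (\<rho> / (lam i - \<gamma>)) ^ N))"

text \<open>The sum of \<open>(lam i - \<gamma>)\<^sup>k d\<^sub>i x\<^sub>i x\<^sub>i\<^sup>H\<close> over \<open>i \<in> I\<close>, written entrywise because matrices of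
  a fixed size do not form a type here.\<close>

definition moment_mat ::
  "complex mat \<Rightarrow> (nat \<Rightarrow> real) \<Rightarrow> real \<Rightarrow> (nat \<Rightarrow> real) \<Rightarrow> nat set \<Rightarrow> nat \<Rightarrow> complex mat" where
  "moment_mat X lam \<gamma> d I k =
     mat (dim_row X) (dim_row X) (\<lambda>(p, q).
       \<Sum>i\<in>I. complex_of_real ((lam i - \<gamma>) ^ k * d i) * (col X i $ p * cnj (col X i $ q)))"

text \<open>The reduced moment of index \<open>i + j\<close> is \<open>S\<^sub>i\<^sup>H B S\<^sub>j\<close>, and that of index \<open>i + j + 1\<close> is
  \<open>S\<^sub>i\<^sup>H (A - \<gamma>B) S\<^sub>j\<close>. The definition picks the representative \<open>i = j = k div 2\<close>, which stays in
  the range \<open>i, j < m\<close> for every \<open>k < 2 * m\<close>; independence of the choice of \<open>i\<close> and \<open>j\<close> is proved in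
  \<open>reduced_moment_index_sum\<close> and \<open>reduced_moment_index_sum_full\<close> below.\<close>

definition reduced_moment ::
  "complex mat \<Rightarrow> complex mat \<Rightarrow> real \<Rightarrow> (nat \<Rightarrow> complex mat) \<Rightarrow> nat \<Rightarrow> complex mat" where
  "reduced_moment A B \<gamma> S k =
     (let i = k div 2 in
      if even k then mat_adjoint (S i) * B * S i
      else mat_adjoint (S i) * (A - complex_of_real \<gamma> \<cdot>\<^sub>m B) * S i)"

definition interval_mat :: "complex mat \<Rightarrow> real mat \<Rightarrow> complex mat set" where
  "interval_mat C R =
     {Z \<in> carrier_mat (dim_row C) (dim_col C).
        \<forall>i < dim_row C. \<forall>j < dim_col C. cmod (Z $$ (i, j) - C $$ (i, j)) \<le> R $$ (i, j)}"


lemma mat_adjoint_carrier: "A \<in> carrier_mat nr nc \<Longrightarrow> mat_adjoint A \<in> carrier_mat nc nr"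
  unfolding mat_adjoint_def by auto

lemma mat_adjoint_index:
  fixes A :: "complex mat"
  assumes "A \<in> carrier_mat nr nc" "i < nc" "j < nr"
  shows "mat_adjoint A $$ (i, j) = cnj (A $$ (j, i))"
  using assms unfolding mat_adjoint_def
  by (auto simp: mat_of_rows_index conjugate_complex_def)

lemma mat_adjoint_mult:
  fixes A B :: "complex mat"
  assumes A: "A \<in> carrier_mat n k" and B: "B \<in> carrier_mat k l"
  shows "mat_adjoint (A * B) = mat_adjoint B * mat_adjoint A"
proof (rule eq_matI)
  note AB = mult_carrier_mat[OF A B]
  have A': "mat_adjoint A \<in> carrier_mat k n" and B': "mat_adjoint B \<in> carrier_mat l k"
    using mat_adjoint_carrier[OF A] mat_adjoint_carrier[OF B] by auto
  show "dim_row (mat_adjoint (A * B)) = dim_row (mat_adjoint B * mat_adjoint A)"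
    "dim_col (mat_adjoint (A * B)) = dim_col (mat_adjoint B * mat_adjoint A)"
    using A' B' mat_adjoint_carrier[OF AB] by auto
  fix i j
  assume "i < dim_row (mat_adjoint B * mat_adjoint A)" "j < dim_col (mat_adjoint B * mat_adjoint A)"
  then have ij: "i < l" "j < n" using A' B' by auto
  show "mat_adjoint (A * B) $$ (i, j) = (mat_adjoint B * mat_adjoint A) $$ (i, j)"
    using ij A B A' B'
    by (simp add: mat_adjoint_index[OF AB] scalar_prod_def mat_adjoint_index[OF A]
        mat_adjoint_index[OF B] mult.commute)
qed

lemma mat_adjoint_twice:
  fixes A :: "complex mat"
  assumes A: "A \<in> carrier_mat nr nc"
  shows "mat_adjoint (mat_adjoint A) = A"
  using mat_adjoint_carrier[OF A] mat_adjoint_carrier[OF mat_adjoint_carrier[OF A]] A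
  by (intro eq_matI) (auto simp: mat_adjoint_index[OF A] mat_adjoint_index[OF mat_adjoint_carrier[OF A]])

definition diagm :: "nat \<Rightarrow> (nat \<Rightarrow> complex) \<Rightarrow> complex mat" where
  "diagm n f = mat n n (\<lambda>(i, j). if i = j then f i else 0)"

lemma diagm_carrier [simp]: "diagm n f \<in> carrier_mat n n"
  unfolding diagm_def by simp

lemma diagm_mult: "diagm n f * diagm n g = diagm n (\<lambda>i. f i * g i)"
  unfolding diagm_def
  by (intro eq_matI)
    (auto simp: scalar_prod_def if_distrib[where f = "\<lambda>x. x * _"] if_distrib[where f = "\<lambda>x. _ * x"]
      cong: if_cong)

lemma diagm_adjoint: "mat_adjoint (diagm n f) = diagm n (\<lambda>i. cnj (f i))"
  using mat_adjoint_carrier[OF diagm_carrier, of n f]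
proof (intro eq_matI)
  fix i j
  assume "i < dim_row (diagm n (\<lambda>i. cnj (f i)))" "j < dim_col (diagm n (\<lambda>i. cnj (f i)))"
  then have "i < n" "j < n" by (auto simp: diagm_def)
  then show "mat_adjoint (diagm n f) $$ (i, j) = diagm n (\<lambda>i. cnj (f i)) $$ (i, j)"
    by (simp add: mat_adjoint_index[OF diagm_carrier]) (simp add: diagm_def)
qed (auto simp: diagm_def)

lemma moment_mat_factor:
  assumes X: "X \<in> carrier_mat n n" and I: "I \<subseteq> {..<n}"
  shows "moment_mat X lam \<gamma> d I k =
    X * diagm n (\<lambda>i. if i \<in> I then complex_of_real ((lam i - \<gamma>) ^ k * d i) else 0) * mat_adjoint X"
    (is "_ = X * diagm n ?f * _")
proof (rule eq_matI)
  note X' = mat_adjoint_carrier[OF X]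
  have XD: "X * diagm n ?f = mat n n (\<lambda>(p, i). X $$ (p, i) * ?f i)"
    using X unfolding diagm_def
    by (intro eq_matI) (auto simp: scalar_prod_def if_distrib[where f = "\<lambda>x. _ * x"] cong: if_cong)
  show "dim_row (moment_mat X lam \<gamma> d I k) = dim_row (X * diagm n ?f * mat_adjoint X)"
    "dim_col (moment_mat X lam \<gamma> d I k) = dim_col (X * diagm n ?f * mat_adjoint X)"
    using X X' by (auto simp: moment_mat_def)
  fix p q
  assume "p < dim_row (X * diagm n ?f * mat_adjoint X)" "q < dim_col (X * diagm n ?f * mat_adjoint X)"
  then have pq: "p < n" "q < n" using X X' by auto
  have "(X * diagm n ?f * mat_adjoint X) $$ (p, q) =
      (\<Sum>i<n. X $$ (p, i) * ?f i * cnj (X $$ (q, i)))"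
    unfolding XD using pq X X'
    by (simp add: scalar_prod_def mat_adjoint_index[OF X] lessThan_atLeast0)
  also have "\<dots> = (\<Sum>i\<in>I. X $$ (p, i) * ?f i * cnj (X $$ (q, i)))"
    using I by (intro sum.mono_neutral_right) auto
  also have "\<dots> = moment_mat X lam \<gamma> d I k $$ (p, q)"
    using pq X I by (auto simp: moment_mat_def intro!: sum.cong)
  finally show "moment_mat X lam \<gamma> d I k $$ (p, q) = (X * diagm n ?f * mat_adjoint X) $$ (p, q)" ..
qed

lemma weierstrass_form_congruence:
  assumes A: "A \<in> carrier_mat n n" and B: "B \<in> carrier_mat n n" and rn: "r \<le> n"
    and W: "weierstrass_form n r A B X lam"
  shows "mat_adjoint X * B * X = diagm n (\<lambda>i. if i < r then 1 else 0)"
    and "mat_adjoint X * (A - complex_of_real \<gamma> \<cdot>\<^sub>m B) * X =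
      diagm n (\<lambda>i. if i < r then complex_of_real (lam i - \<gamma>) else 1)"
proof -
  have X: "X \<in> carrier_mat n n" using W unfolding weierstrass_form_def by auto
  note X' = mat_adjoint_carrier[OF X]
  have D: "diag_block_mat [1\<^sub>m r, 0\<^sub>m (n - r) (n - r)] = diagm n (\<lambda>i. if i < r then 1 else 0)"
    using rn by (intro eq_matI) (auto simp: diagm_def Let_def)
  have L: "diag_block_mat [mat r r (\<lambda>(i, j). if i = j then complex_of_real (lam i) else 0),
      1\<^sub>m (n - r)] = diagm n (\<lambda>i. if i < r then complex_of_real (lam i) else 1)"
    using rn by (intro eq_matI) (auto simp: diagm_def Let_def)
  have lin: "mat_adjoint X * (z \<cdot>\<^sub>m B - A) * X
      = z \<cdot>\<^sub>m (mat_adjoint X * B * X) - mat_adjoint X * A * X" for z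
  proof -
    have "mat_adjoint X * (z \<cdot>\<^sub>m B - A) = z \<cdot>\<^sub>m (mat_adjoint X * B) - mat_adjoint X * A"
      using mult_minus_distrib_mat[OF X', of "z \<cdot>\<^sub>m B" n A] A B
      by (simp add: mult_smult_distrib[OF X' B])
    moreover have "(z \<cdot>\<^sub>m (mat_adjoint X * B) - mat_adjoint X * A) * X
        = z \<cdot>\<^sub>m (mat_adjoint X * B) * X - mat_adjoint X * A * X"
      using X X' A B by (intro minus_mult_distrib_mat) auto
    moreover have "z \<cdot>\<^sub>m (mat_adjoint X * B) * X = z \<cdot>\<^sub>m (mat_adjoint X * B * X)"
      using X X' B by (intro mult_smult_assoc_mat) auto
    ultimately show ?thesis by simp
  qed
  define P where "P = mat_adjoint X * A * X"
  define Q where "Q = mat_adjoint X * B * X"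
  have PQ: "P \<in> carrier_mat n n" "Q \<in> carrier_mat n n" using X X' A B by (auto simp: P_def Q_def)
  have eq: "z \<cdot>\<^sub>m Q - P = z \<cdot>\<^sub>m diagm n (\<lambda>i. if i < r then 1 else 0)
      - diagm n (\<lambda>i. if i < r then complex_of_real (lam i) else 1)" for z
    using W lin[of z] unfolding weierstrass_form_def P_def Q_def D L by metis
  have ent: "z * Q $$ (i, j) - P $$ (i, j) =
      (if i = j then (if i < r then z - complex_of_real (lam i) else - 1) else 0)"
    if "i < n" "j < n" for z i j
  proof -
    have "(z \<cdot>\<^sub>m Q - P) $$ (i, j) = (z \<cdot>\<^sub>m diagm n (\<lambda>i. if i < r then 1 else 0)
      - diagm n (\<lambda>i. if i < r then complex_of_real (lam i) else 1)) $$ (i, j)"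
      using eq by simp
    then show ?thesis using that PQ by (auto simp: diagm_def split: if_splits)
  qed
  have Pe: "P $$ (i, j) = (if i = j then (if i < r then complex_of_real (lam i) else 1) else 0)"
    if "i < n" "j < n" for i j
    using ent[OF that, of 0] by (auto split: if_splits simp: minus_equation_iff)
  have Qe: "Q $$ (i, j) = (if i = j \<and> i < r then 1 else 0)"
    if "i < n" "j < n" for i j
    using ent[OF that, of 1] Pe[OF that] by (auto split: if_splits)
  show Q: "mat_adjoint X * B * X = diagm n (\<lambda>i. if i < r then 1 else 0)"
    unfolding Q_def[symmetric] using PQ Qe by (intro eq_matI) (auto simp: diagm_def)
  have X0: "mat_adjoint X * (A - complex_of_real \<gamma> \<cdot>\<^sub>m B) * X = P - complex_of_real \<gamma> \<cdot>\<^sub>m Q"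
  proof -
    have "mat_adjoint X * (A - complex_of_real \<gamma> \<cdot>\<^sub>m B)
        = mat_adjoint X * A - complex_of_real \<gamma> \<cdot>\<^sub>m (mat_adjoint X * B)"
      using mult_minus_distrib_mat[OF X' A, of "complex_of_real \<gamma> \<cdot>\<^sub>m B"] B
      by (simp add: mult_smult_distrib[OF X' B])
    moreover have "(mat_adjoint X * A - complex_of_real \<gamma> \<cdot>\<^sub>m (mat_adjoint X * B)) * X
        = mat_adjoint X * A * X - complex_of_real \<gamma> \<cdot>\<^sub>m (mat_adjoint X * B) * X"
      using X X' A B by (intro minus_mult_distrib_mat) auto
    moreover have "complex_of_real \<gamma> \<cdot>\<^sub>m (mat_adjoint X * B) * X
        = complex_of_real \<gamma> \<cdot>\<^sub>m (mat_adjoint X * B * X)"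
      using X X' B by (intro mult_smult_assoc_mat) auto
    ultimately show ?thesis by (simp add: P_def Q_def)
  qed
  show "mat_adjoint X * (A - complex_of_real \<gamma> \<cdot>\<^sub>m B) * X =
      diagm n (\<lambda>i. if i < r then complex_of_real (lam i - \<gamma>) else 1)"
    unfolding X0 using PQ Pe Qe by (intro eq_matI) (auto simp: diagm_def)
qed

lemma congruence_sandwich:
  assumes X: "X \<in> carrier_mat n n" and W: "W \<in> carrier_mat n l" and P: "P \<in> carrier_mat n n"
    and PX: "mat_adjoint X * P * X = diagm n h"
  shows "mat_adjoint (X * diagm n f * W) * P * (X * diagm n g * W) =
    mat_adjoint W * diagm n (\<lambda>i. cnj (f i) * h i * g i) * W"
proof -
  note X' = mat_adjoint_carrier[OF X] and W' = mat_adjoint_carrier[OF W]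
  note D = diagm_carrier[of n]
  note c = mult_carrier_mat
  have 1: "mat_adjoint (X * diagm n f * W)
      = mat_adjoint W * (diagm n (\<lambda>i. cnj (f i)) * mat_adjoint X)"
    by (simp add: mat_adjoint_mult[OF c[OF X D] W] mat_adjoint_mult[OF X D] diagm_adjoint)
  have "mat_adjoint (X * diagm n f * W) * P * (X * diagm n g * W)
      = mat_adjoint W * (diagm n (\<lambda>i. cnj (f i)) * (mat_adjoint X * P * X) * diagm n g) * W"
    unfolding 1
    using X X' W W' P D
    by (smt (verit) c assoc_mult_mat)
  also have "\<dots> = mat_adjoint W * diagm n (\<lambda>i. cnj (f i) * h i * g i) * W"
    unfolding PX by (simp add: diagm_mult)
  finally show ?thesis .
qed

lemma reduced_moment_index_sum:
  assumes A: "A \<in> carrier_mat n n" and B: "B \<in> carrier_mat n n" and V: "V \<in> carrier_mat n l"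
    and rn: "r \<le> n" and W: "weierstrass_form n r A B X lam" and I: "I \<subseteq> {..<r}"
    and S: "S = (\<lambda>k. moment_mat X lam \<gamma> d I k * B * V)"
  shows "mat_adjoint (S i) * B * S j = reduced_moment A B \<gamma> S (i + j)"
    and "mat_adjoint (S i) * (A - complex_of_real \<gamma> \<cdot>\<^sub>m B) * S j
      = reduced_moment A B \<gamma> S (i + j + 1)"
proof -
  have X: "X \<in> carrier_mat n n" using W unfolding weierstrass_form_def by auto
  note X' = mat_adjoint_carrier[OF X]
  define U where "U = mat_adjoint X * B * V"
  have U: "U \<in> carrier_mat n l" using X' B V by (auto simp: U_def)
  define f where "f k = (\<lambda>i. if i \<in> I then complex_of_real ((lam i - \<gamma>) ^ k * d i) else 0)" for k
  define G where "G k = mat_adjoint U *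
    diagm n (\<lambda>i. if i \<in> I then complex_of_real ((lam i - \<gamma>) ^ k * (d i)\<^sup>2) else 0) * U" for k
  have In: "I \<subseteq> {..<n}" using I rn by auto
  have Sk: "S k = X * diagm n (f k) * U" for k
    unfolding S moment_mat_factor[OF X In] f_def[symmetric] U_def
    using X X' B V diagm_carrier[of n "f k"] by (smt (verit) mult_carrier_mat assoc_mult_mat)
  note con = weierstrass_form_congruence[OF A B rn W]
  have AB: "A - complex_of_real \<gamma> \<cdot>\<^sub>m B \<in> carrier_mat n n" using A B by auto
  have 1: "mat_adjoint (S i) * B * S j = G (i + j)" for i j
    unfolding Sk congruence_sandwich[OF X U B con(1)] G_def
    by (rule arg_cong[where f = "\<lambda>g. mat_adjoint U * diagm n g * U"])
      (use I in \<open>auto simp: f_def fun_eq_iff power_add power2_eq_square\<close>)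
  have 2: "mat_adjoint (S i) * (A - complex_of_real \<gamma> \<cdot>\<^sub>m B) * S j = G (i + j + 1)" for i j
    unfolding Sk congruence_sandwich[OF X U AB con(2)] G_def
    by (rule arg_cong[where f = "\<lambda>g. mat_adjoint U * diagm n g * U"])
      (use I in \<open>auto simp: f_def fun_eq_iff power_add power2_eq_square\<close>)
  have "reduced_moment A B \<gamma> S k = G k" for k
  proof (cases "even k")
    case True
    then show ?thesis unfolding reduced_moment_def Let_def 1 by (auto elim!: evenE simp: mult_2)
  next
    case False
    then have "k div 2 + k div 2 + 1 = k" by presburger
    with False show ?thesis unfolding reduced_moment_def Let_def 2 by simp
  qed
  then show "mat_adjoint (S i) * B * S j = reduced_moment A B \<gamma> S (i + j)"
    and "mat_adjoint (S i) * (A - complex_of_real \<gamma> \<cdot>\<^sub>m B) * S j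
      = reduced_moment A B \<gamma> S (i + j + 1)"
    using 1 2 by auto
qed

lemma moment_mat_split:
  assumes "t \<le> r"
  shows "moment_mat X lam \<gamma> d {..<t} k + moment_mat X lam \<gamma> d {t..<r} k
    = moment_mat X lam \<gamma> d {..<r} k"
proof -
  have "{..<r} = {..<t} \<union> {t..<r}" using assms by auto
  then show ?thesis
    by (intro eq_matI)
      (auto simp: moment_mat_def sum.union_disjoint ivl_disj_int_one)
qed

lemma reduced_moment_index_sum_full:
  assumes "A \<in> carrier_mat n n" "B \<in> carrier_mat n n" "V \<in> carrier_mat n l"
    and "r \<le> n" "t \<le> r" and "weierstrass_form n r A B X lam"
    and "S = (\<lambda>k. (moment_mat X lam \<gamma> d {..<t} k + moment_mat X lam \<gamma> d {t..<r} k) * B * V)"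
  shows "mat_adjoint (S i) * B * S j = reduced_moment A B \<gamma> S (i + j)"
    and "mat_adjoint (S i) * (A - complex_of_real \<gamma> \<cdot>\<^sub>m B) * S j
      = reduced_moment A B \<gamma> S (i + j + 1)"
  using reduced_moment_index_sum[OF assms(1-4,6) order_refl, of S \<gamma> d i j] assms(5,7)
  by (simp_all add: moment_mat_split)

end

theory Submission
  imports Defs
begin

text \<open>The columns of \<open>X\<close> that belong to different indices are orthogonal with respect to both
  \<open>B\<close> and \<open>A - \<gamma>B\<close>, since \<open>X\<close> diagonalizes the two forms simultaneously. Substituting
  \<open>S\<^sub>k = X diag((\<lambda>\<^sub>i - \<gamma>)\<^sup>k d\<^sub>i) X\<^sup>H B V\<close> into a reduced moment therefore leaves a diagonal sandwich
  \<open>U\<^sup>H diag((\<lambda>\<^sub>i - \<gamma>)\<^sup>k d\<^sub>i\<^sup>2) U\<close> with \<open>U = X\<^sup>H B V\<close>, supported on the indices that were summed over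
  (\<open>reduced_moment_spectral\<close>). Although a reduced moment is quadratic in \<open>S\<close>, it is hence
  additive in the index set: the mixed terms between the eigenvalues inside and those outside
  \<open>\<Omega>\<close> vanish and the full moment is the sum of its inner and outer parts
  (\<open>reduced_moment_disjoint_union\<close>).

  The inner moment thus differs from the full one by exactly the outer one, which is the first
  claim with equality in every entry. The second claim is the triangle inequality for a change
  of center (\<open>interval_mat_recenter\<close>).\<close>

lemma diagm_add: "diagm n f + diagm n g = diagm n (\<lambda>i. f i + g i)"
  by (intro eq_matI) (auto simp: diagm_def)

text \<open>Even and odd moments use different Gram matrices, but the diagonal of \<open>A - \<gamma>B\<close> in the basis
  \<open>X\<close> supplies precisely the factor \<open>\<lambda>\<^sub>i - \<gamma>\<close> that is missing from the two powers with exponent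
  \<open>k div 2\<close>, so that one formula covers both parities.\<close>

lemma reduced_moment_spectral:
  assumes A: "A \<in> carrier_mat n n" and B: "B \<in> carrier_mat n n" and V: "V \<in> carrier_mat n l"
    and rn: "r \<le> n" and W: "weierstrass_form n r A B X lam" and I: "I \<subseteq> {..<r}"
  defines "U \<equiv> mat_adjoint X * B * V"
  shows "reduced_moment A B \<gamma> (\<lambda>k. moment_mat X lam \<gamma> d I k * B * V) k =
    mat_adjoint U *
      diagm n (\<lambda>i. if i \<in> I then complex_of_real ((lam i - \<gamma>) ^ k * (d i)\<^sup>2) else 0) * U"
proof -
  have X: "X \<in> carrier_mat n n" using W unfolding weierstrass_form_def by auto
  note X' = mat_adjoint_carrier[OF X]
  have U: "U \<in> carrier_mat n l" using X' B V by (auto simp: U_def)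
  have In: "I \<subseteq> {..<n}" using I rn by auto
  have AB: "A - complex_of_real \<gamma> \<cdot>\<^sub>m B \<in> carrier_mat n n" using A B by auto
  define f where "f j = (\<lambda>i. if i \<in> I then complex_of_real ((lam i - \<gamma>) ^ j * d i) else 0)" for j
  have factor: "moment_mat X lam \<gamma> d I j * B * V = X * diagm n (f j) * U" for j
  proof -
    note D = diagm_carrier[of n "f j"]
    have XD: "X * diagm n (f j) \<in> carrier_mat n n" using X D by auto
    have "X * diagm n (f j) * mat_adjoint X * B * V
        = X * diagm n (f j) * (mat_adjoint X * B) * V"
      using assoc_mult_mat[OF XD X' B] by simp
    also have "\<dots> = X * diagm n (f j) * U"
      unfolding U_def using X' B by (intro assoc_mult_mat[OF XD _ V]) auto
    finally show ?thesis unfolding moment_mat_factor[OF X In] f_def[symmetric] .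
  qed
  note con = weierstrass_form_congruence[OF A B rn W]
  have exponent: "k = k div 2 + k div 2 + k mod 2" by presburger
  have pow: "(x :: real) ^ k = x ^ (k div 2) * x ^ (k div 2) * x ^ (k mod 2)" for x
    by (subst exponent) (simp only: power_add)
  show ?thesis
  proof (cases "even k")
    case True
    then have "k mod 2 = 0" by presburger
    with True show ?thesis
      unfolding reduced_moment_def Let_def factor congruence_sandwich[OF X U B con(1)]
      using I by (auto simp: f_def pow power2_eq_square fun_eq_iff
          intro!: arg_cong[where f = "\<lambda>g. mat_adjoint U * diagm n g * U"])
  next
    case False
    then have "k mod 2 = 1" by presburger
    with False show ?thesis
      unfolding reduced_moment_def Let_def factor congruence_sandwich[OF X U AB con(2)]
      using I by (auto simp: f_def pow power2_eq_square fun_eq_iff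
          intro!: arg_cong[where f = "\<lambda>g. mat_adjoint U * diagm n g * U"])
  qed
qed

lemma reduced_moment_carrier:
  assumes "\<And>k. S k \<in> carrier_mat n l"
  shows "reduced_moment A B \<gamma> S k \<in> carrier_mat l l"
  using mat_adjoint_carrier[OF assms, of "k div 2"] assms[of "k div 2"]
  by (auto simp: reduced_moment_def Let_def)

text \<open>The diagonal middle factor is a sum of one contribution per index, and it is the only factor
  of the spectral formula that sees the index set.\<close>

lemma reduced_moment_disjoint_union:
  assumes A: "A \<in> carrier_mat n n" and B: "B \<in> carrier_mat n n" and V: "V \<in> carrier_mat n l"
    and rn: "r \<le> n" and W: "weierstrass_form n r A B X lam"
    and IJ: "I \<union> J \<subseteq> {..<r}" and disj: "I \<inter> J = {}"
  shows "reduced_moment A B \<gamma> (\<lambda>k. moment_mat X lam \<gamma> d (I \<union> J) k * B * V) k =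
    reduced_moment A B \<gamma> (\<lambda>k. moment_mat X lam \<gamma> d I k * B * V) k +
    reduced_moment A B \<gamma> (\<lambda>k. moment_mat X lam \<gamma> d J k * B * V) k"
proof -
  have X: "X \<in> carrier_mat n n" using W unfolding weierstrass_form_def by auto
  define U where "U = mat_adjoint X * B * V"
  have U: "U \<in> carrier_mat n l" using mat_adjoint_carrier[OF X] B V by (auto simp: U_def)
  note U' = mat_adjoint_carrier[OF U]
  define g where "g K = (\<lambda>i. if i \<in> K then complex_of_real ((lam i - \<gamma>) ^ k * (d i)\<^sup>2) else 0)" for K
  have g: "g (I \<union> J) = (\<lambda>i. g I i + g J i)" using disj by (auto simp: g_def fun_eq_iff)
  have sandwich: "mat_adjoint U * diagm n (g K) \<in> carrier_mat l n" for K
    using U' diagm_carrier by auto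
  note spectral = reduced_moment_spectral[OF A B V rn W, folded U_def]
  have "mat_adjoint U * diagm n (g (I \<union> J)) * U
      = (mat_adjoint U * diagm n (g I) + mat_adjoint U * diagm n (g J)) * U"
    unfolding g diagm_add[symmetric] mult_add_distrib_mat[OF U' diagm_carrier diagm_carrier] ..
  also have "\<dots> = mat_adjoint U * diagm n (g I) * U + mat_adjoint U * diagm n (g J) * U"
    by (rule add_mult_distrib_mat[OF sandwich sandwich U])
  finally show ?thesis using IJ by (simp add: spectral g_def)
qed

lemma summand_in_interval_mat:
  assumes "P \<in> carrier_mat p q" "Q \<in> carrier_mat p q"
  shows "P \<in> interval_mat (P + Q) (map_mat cmod Q)"
  using assms by (auto simp: interval_mat_def)

lemma interval_mat_recenter:
  assumes "C \<in> carrier_mat p q" "C' \<in> carrier_mat p q" "R \<in> carrier_mat p q"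
  shows "interval_mat C R \<subseteq> interval_mat C' (R + map_mat cmod (C' - C))"
proof
  fix Z
  assume Z: "Z \<in> interval_mat C R"
  have "cmod (Z $$ (i, j) - C' $$ (i, j)) \<le> R $$ (i, j) + cmod (C' $$ (i, j) - C $$ (i, j))"
    if "i < p" "j < q" for i j
  proof -
    have "cmod (Z $$ (i, j) - C $$ (i, j)) \<le> R $$ (i, j)"
      using Z that assms by (auto simp: interval_mat_def)
    then show ?thesis
      using norm_triangle_ineq4[of "Z $$ (i, j) - C $$ (i, j)" "C' $$ (i, j) - C $$ (i, j)"] by simp
  qed
  with Z assms show "Z \<in> interval_mat C' (R + map_mat cmod (C' - C))"
    by (auto simp: interval_mat_def)
qed

theorem theorem2p3:
  fixes A B X V :: "complex mat"
    and lam d :: "nat \<Rightarrow> real"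
    and a b \<gamma> \<rho> :: real
    and n r t N l m :: nat
    and M_in M_out M S S_in S_out Mom Mom_in Mom_out Mom_num :: "nat \<Rightarrow> complex mat"
  assumes "A \<in> carrier_mat n n" and "B \<in> carrier_mat n n"
    and "hermitian_mat A" and "psd_mat B"
    and "r = vec_space.rank n B"
    and "regular_pencil A B"
    and "weierstrass_form n r A B X lam"
    and "a < b" and "\<gamma> = (a + b) / 2" and "\<rho> = (b - a) / 2"
    and "t \<le> r"
    and "\<forall>i<t. lam i \<in> {a..b}"
    and "\<forall>i\<in>{t..<r}. lam i \<notin> {a..b}"
    and "\<not> pencil_eigenvalue A B (complex_of_real a)"
    and "\<not> pencil_eigenvalue A B (complex_of_real b)"
    and "N > 0" and "l > 0" and "m > 0"
    and "V \<in> carrier_mat n l"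
    and "d = filter_coeff \<gamma> \<rho> N t lam"
    and "M_in = moment_mat X lam \<gamma> d {..<t}"
    and "M_out = moment_mat X lam \<gamma> d {t..<r}"
    and "M = (\<lambda>k. M_in k + M_out k)"
    and "S = (\<lambda>k. M k * B * V)"
    and "S_in = (\<lambda>k. M_in k * B * V)"
    and "S_out = (\<lambda>k. M_out k * B * V)"
    and "Mom = reduced_moment A B \<gamma> S"
    and "Mom_in = reduced_moment A B \<gamma> S_in"
    and "Mom_out = reduced_moment A B \<gamma> S_out"
    and "\<forall>k<2 * m. Mom_num k \<in> carrier_mat l l"
  shows "\<forall>k<2 * m.
    Mom_in k \<in> interval_mat (Mom k) (map_mat cmod (Mom_out k)) \<and>
    interval_mat (Mom k) (map_mat cmod (Mom_out k)) \<subseteq>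
      interval_mat (Mom_num k)
        (map_mat cmod (Mom_out k) + map_mat cmod (Mom_num k - Mom k))"
proof (intro allI impI)
  fix k
  assume k: "k < 2 * m"
  note A = assms(1) and B = assms(2) and W = assms(7) and tr = \<open>t \<le> r\<close>
    and V = \<open>V \<in> carrier_mat n l\<close>
  have rn: "r \<le> n" unfolding assms(5) by (rule vec_space.rank_le_nc[OF B])
  have X: "X \<in> carrier_mat n n" using W unfolding weierstrass_form_def by auto
  have in_carrier: "Mom_in k \<in> carrier_mat l l" and out_carrier: "Mom_out k \<in> carrier_mat l l"
    unfolding \<open>Mom_in = _\<close> \<open>Mom_out = _\<close> \<open>S_in = _\<close> \<open>S_out = _\<close> \<open>M_in = _\<close> \<open>M_out = _\<close>
    by (rule reduced_moment_carrier[of _ n]; use X B V in \<open>auto simp: moment_mat_def\<close>)+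
  have union: "{..<t} \<union> {t..<r} = {..<r}" using tr by auto
  have split: "Mom k = Mom_in k + Mom_out k"
    using reduced_moment_disjoint_union[OF A B V rn W, of "{..<t}" "{t..<r}" \<gamma> d k]
    unfolding \<open>Mom = _\<close> \<open>Mom_in = _\<close> \<open>Mom_out = _\<close> \<open>S = _\<close> \<open>S_in = _\<close> \<open>S_out = _\<close>
      \<open>M = _\<close> \<open>M_in = _\<close> \<open>M_out = _\<close> moment_mat_split[OF tr] union
    by (simp add: ivl_disj_int_one)
  have carrier: "Mom k \<in> carrier_mat l l" unfolding split using in_carrier out_carrier by auto
  show "Mom_in k \<in> interval_mat (Mom k) (map_mat cmod (Mom_out k)) \<and>
    interval_mat (Mom k) (map_mat cmod (Mom_out k)) \<subseteq>
      interval_mat (Mom_num k)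
        (map_mat cmod (Mom_out k) + map_mat cmod (Mom_num k - Mom k))"
  proof
    show "Mom_in k \<in> interval_mat (Mom k) (map_mat cmod (Mom_out k))"
      unfolding split by (rule summand_in_interval_mat[OF in_carrier out_carrier])
    have "Mom_num k \<in> carrier_mat l l" using assms(30) k by blast
    then show "interval_mat (Mom k) (map_mat cmod (Mom_out k)) \<subseteq>
      interval_mat (Mom_num k)
        (map_mat cmod (Mom_out k) + map_mat cmod (Mom_num k - Mom k))"
      using out_carrier by (intro interval_mat_recenter[OF carrier]) auto
  qed
qed

end
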